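(* As formal power series in $q$ (equivalently, for $|q|<1$), $$\sum_{n=0}^{\infty}\sigma_{od}\mathrm{moex}(n)\,q^n= \frac{(-q;q^2)_{\infty}}{(q^2;q^2)_{\infty}}\bigl(1+\sigma^*(-q)\bigr)$$ and $$\sum_{n=0}^{\infty}\sigma_{od}\mathrm{meex}(n)\,q^n=2 \sum_{n=0}^{\infty}p_{ed}(n)q^n,$$ where $\sigma^*(q):=2\sum_{n=1}^{\infty}\frac{(-1)^nq^{n^2}}{(q;q^2)_n}$.
   Context: Notation: $(a;q)_0:=1$, $(a;q)_n:=\prod_{k=0}^{n-1}(1-aq^k)$, $(a;q)_\infty:=\lim_{n\to\infty}(a;q)_n$. For $n\ge 0$, $\mathcal{P}_{od}(n)$ is the set of all partitions of $n$ in which no odd part is repeated (even parts may appear with any multiplicity), and $p_{ed}(n)$ is the number of partitions of $n$ in which no even part is repeated (odd parts may appear with any multiplicity), with $p_{ed}(0)=1$. The empty partition is the unique element of $\mathcal{P}_{od}(0)$. For $\lambda\in\mathcal{P}_{od}(n)$, $\mathrm{moex}(\lambda)$ (resp. $\mathrm{meex}(\lambda)$) is the smallest positive odd (resp. positive even) integer that is not a part of $\lambda$. Define $$\sigma_{od}\mathrm{moex}(n):=\sum_{\lambda\in\mathcal{P}_{od}(n)}\mathrm{moex}(\lambda),\qquad \sigma_{od}\mathrm{meex}(n):=\sum_{\lambda\in\mathcal{P}_{od}(n)}\mathrm{meex}(\lambda).$$ *)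

theory Defs
  imports
    "HOL-Computational_Algebra.Formal_Power_Series"
    "HOL-Library.Multiset"
begin

section \<open>Partitions\<close>

definition partitions_of :: "nat \<Rightarrow> nat multiset set" where
  "partitions_of n = {\<mu>. 0 \<notin># \<mu> \<and> sum_mset \<mu> = n}"

definition P_od :: "nat \<Rightarrow> nat multiset set" where
  "P_od n = {\<mu> \<in> partitions_of n. \<forall>i. odd i \<longrightarrow> count \<mu> i \<le> 1}"

definition p_ed :: "nat \<Rightarrow> nat" where
  "p_ed n = card {\<mu> \<in> partitions_of n. \<forall>i. even i \<longrightarrow> count \<mu> i \<le> 1}"

definition moex :: "nat multiset \<Rightarrow> nat" where
  "moex \<mu> = (LEAST k. odd k \<and> k \<notin># \<mu>)"

definition meex :: "nat multiset \<Rightarrow> nat" where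
  "meex \<mu> = (LEAST k. 0 < k \<and> even k \<and> k \<notin># \<mu>)"

definition sigma_od_moex :: "nat \<Rightarrow> nat" where
  "sigma_od_moex n = (\<Sum>\<mu>\<in>P_od n. moex \<mu>)"

definition sigma_od_meex :: "nat \<Rightarrow> nat" where
  "sigma_od_meex n = (\<Sum>\<mu>\<in>P_od n. meex \<mu>)"

lemma finite_partitions_of: "finite (partitions_of n)"
proof -
  have size_le: "size \<mu> \<le> sum_mset \<mu>" if "0 \<notin># \<mu>" for \<mu> :: "nat multiset"
    using that by (induction \<mu>) auto
  have part_le: "i \<le> sum_mset \<mu>" if "i \<in># \<mu>" for i :: nat and \<mu>
    using multi_member_split[OF that] by auto
  have "partitions_of n \<subseteq> (\<Union>k\<le>n. multisets_of_size {..n} k)"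
    using size_le part_le unfolding partitions_of_def multisets_of_size_def by blast
  moreover have "finite (\<Union>k\<le>n. multisets_of_size {..n} k)"
    by (intro finite_UN_I finite_multisets_of_size) auto
  ultimately show ?thesis
    by (rule finite_subset)
qed

lemma finite_P_od: "finite (P_od n)"
  using finite_partitions_of[of n] by (simp add: P_od_def)


section \<open>q-series in the ring of formal power series\<close>

text \<open>
  Infinite products and sums are limits in the standard topology on \<^typ>\<open>'a fps\<close>, in which
  convergence means that every coefficient is eventually constant.
\<close>

definition qpochhammer :: "'a::comm_ring_1 \<Rightarrow> 'a \<Rightarrow> nat \<Rightarrow> 'a" where
  "qpochhammer a q n = (\<Prod>k<n. 1 - a * q ^ k)"

definition qpochhammer_inf :: "'a::comm_ring_1 fps \<Rightarrow> 'a fps \<Rightarrow> 'a fps" where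
  "qpochhammer_inf a q = lim (\<lambda>n. qpochhammer a q n)"

definition sigma_star :: "'a::field fps \<Rightarrow> 'a fps" where
  "sigma_star q =
     2 * (\<Sum>n. (- 1) ^ Suc n * q ^ ((Suc n)\<^sup>2) / qpochhammer q (q\<^sup>2) (Suc n))"

unbundle fps_syntax

lemma fps_nth_mult_power_eq_0:
  fixes a q :: "'a::comm_ring_1 fps"
  assumes "q $ 0 = 0" "k < n"
  shows "(a * q ^ n) $ k = 0"
proof -
  have "(q ^ n) $ i = 0" if "i < n" for i
    using assms(1) that by (intro startsby_zero_power_prefix[rule_format]) auto
  then show ?thesis
    using assms(2) by (simp add: fps_mult_nth)
qed

lemma fps_convergentI:
  fixes f :: "nat \<Rightarrow> 'a::group_add fps"
  assumes "\<And>n k. k < n \<Longrightarrow> f (Suc n) $ k = f n $ k"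
  shows "convergent f"
proof -
  have eq: "f n $ k = f (Suc k) $ k" if "Suc k \<le> n" for n k
    using that by (induction rule: dec_induct) (auto simp: assms)
  have "f \<longlonglongrightarrow> Abs_fps (\<lambda>k. f (Suc k) $ k)"
  proof (rule tendsto_fpsI)
    fix k :: nat
    show "eventually (\<lambda>n. f n $ k = Abs_fps (\<lambda>k. f (Suc k) $ k) $ k) sequentially"
      using eventually_ge_at_top[of "Suc k"]
      by (rule eventually_mono) (unfold fps_nth_Abs_fps, erule eq)
  qed
  then show ?thesis
    by (rule convergentI)
qed

lemma convergent_qpochhammer:
  fixes a q :: "'a::comm_ring_1 fps"
  assumes "q $ 0 = 0"
  shows "convergent (\<lambda>n. qpochhammer a q n)"
proof (rule fps_convergentI)
  fix n k :: nat
  assume "k < n"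
  have "qpochhammer a q (Suc n) = qpochhammer a q n - (qpochhammer a q n * a) * q ^ n"
    by (simp add: qpochhammer_def algebra_simps)
  then show "qpochhammer a q (Suc n) $ k = qpochhammer a q n $ k"
    using fps_nth_mult_power_eq_0[OF assms \<open>k < n\<close>] by simp
qed

lemma summable_sigma_star:
  fixes q :: "'a::field fps"
  assumes "q $ 0 = 0"
  shows "summable (\<lambda>n. (- 1) ^ Suc n * q ^ ((Suc n)\<^sup>2) / qpochhammer q (q\<^sup>2) (Suc n))"
    (is "summable ?f")
proof -
  have "convergent (\<lambda>n. \<Sum>i<n. ?f i)"
  proof (rule fps_convergentI)
    fix n k :: nat
    assume "k < n"
    have unit: "qpochhammer q (q\<^sup>2) m $ 0 = 1" for m
      using assms by (induction m) (simp_all add: qpochhammer_def)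
    have "?f n = ((- 1) ^ Suc n * inverse (qpochhammer q (q\<^sup>2) (Suc n))) * q ^ ((Suc n)\<^sup>2)"
      using unit[of "Suc n"] by (simp only: fps_divide_unit one_neq_zero not_False_eq_True mult_ac)
    moreover have "k < (Suc n)\<^sup>2"
      using \<open>k < n\<close> by (simp add: power2_eq_square)
    ultimately have "?f n $ k = 0"
      by (simp only: fps_nth_mult_power_eq_0[OF assms])
    then show "(\<Sum>i<Suc n. ?f i) $ k = (\<Sum>i<n. ?f i) $ k"
      by (simp only: sum.lessThan_Suc fps_add_nth add_0_right)
  qed
  then show ?thesis
    by (simp add: summable_iff_convergent)
qed

end

theory Submission
  imports Defs
begin

text \<open>
  Write the minimal excludant as a count: \<open>moex \<lambda> = 1 + 2 t\<close>, where \<open>t\<close> is the number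
  of \<open>m \<ge> 1\<close> for which \<open>1, 3, \<dots>, 2m - 1\<close> all are parts of \<open>\<lambda>\<close>, and likewise
  \<open>meex \<lambda> = 2 + 2 t\<close> for \<open>2, 4, \<dots>, 2m\<close>. If \<open>G\<close> is the generating function of all partitions
  without repeated odd parts, then requiring the first \<open>m\<close> odd parts multiplies \<open>G\<close> by
  \<open>q\<^bsup>m\<^sup>2\<^esup> / (-q;q\<^sup>2)\<^sub>m\<close>, and requiring the first \<open>m\<close> even parts multiplies it by
  \<open>q\<^bsup>m(m+1)\<^esup>\<close>. Summing over \<open>m\<close> gives the first identity at once. For the second one it
  remains to apply Gauss's identity \<open>\<Sum> q\<^bsup>m(m+1)/2\<^esup> = (q\<^sup>2;q\<^sup>2)\<^sub>\<infinity> / (q;q\<^sup>2)\<^sub>\<infinity>\<close>, with \<open>q\<^sup>2\<close> in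
  place of \<open>q\<close>. Gauss's identity is the limit of a finite identity of Shanks, which telescopes.
\<close>

subsection \<open>Limits of power series\<close>

instance fps :: (ab_group_add) topological_comm_monoid_add
proof
  fix f g :: "'a fps"
  show "((\<lambda>x. fst x + snd x) \<longlongrightarrow> f + g) (nhds f \<times>\<^sub>F nhds g)"
  proof (rule tendsto_fpsI)
    fix n
    have "\<forall>\<^sub>F x in nhds f \<times>\<^sub>F nhds g. fst x $ n = f $ n \<and> snd x $ n = g $ n"
      by (intro eventually_prodI eventually_fps_nth_eq_nhds_fps)
    then show "\<forall>\<^sub>F x in nhds f \<times>\<^sub>F nhds g. (fst x + snd x) $ n = (f + g) $ n"
      by eventually_elim simp
  qed
qed

instance fps :: (ring) topological_semigroup_mult
proof
  fix f g :: "'a fps"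
  show "((\<lambda>x. fst x * snd x) \<longlongrightarrow> f * g) (nhds f \<times>\<^sub>F nhds g)"
  proof (rule tendsto_fpsI)
    fix n
    have "\<forall>\<^sub>F x in nhds f \<times>\<^sub>F nhds g. (\<forall>k\<le>n. fst x $ k = f $ k) \<and> (\<forall>k\<le>n. snd x $ k = g $ k)"
      by (intro eventually_prodI eventually_fps_nth_eq_nhds_fps_strong)
    then show "\<forall>\<^sub>F x in nhds f \<times>\<^sub>F nhds g. (fst x * snd x) $ n = (f * g) $ n"
      by eventually_elim (simp add: fps_mult_nth)
  qed
qed

lemma sums_cmult_left:
  fixes c :: "'a::{semiring_0, topological_semigroup_mult}"
  assumes "f sums s"
  shows "(\<lambda>n. c * f n) sums (c * s)"
  using tendsto_mult_left[of _ s sequentially c] assms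
  unfolding sums_def sum_distrib_left[symmetric] by blast

lemma tendsto_fps_mult_power_0:
  fixes q :: "'a::comm_ring_1 fps"
  assumes "q $ 0 = 0" "\<And>n. n \<le> e n"
  shows "(\<lambda>n. a n * q ^ e n) \<longlonglongrightarrow> 0"
proof (rule tendsto_fpsI)
  fix k
  show "\<forall>\<^sub>F n in sequentially. (a n * q ^ e n) $ k = 0 $ k"
    using eventually_gt_at_top[of k]
    by eventually_elim (use assms in \<open>simp add: fps_nth_mult_power_eq_0 less_le_trans\<close>)
qed

lemma summable_fps_mult_power:
  fixes q :: "'a::comm_ring_1 fps"
  assumes "q $ 0 = 0" "\<And>n. n \<le> e n"
  shows "summable (\<lambda>n. a n * q ^ e n)"
  unfolding summable_iff_convergent
proof (rule fps_convergentI)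
  fix n k :: nat
  assume "k < n"
  then show "(\<Sum>i<Suc n. a i * q ^ e i) $ k = (\<Sum>i<n. a i * q ^ e i) $ k"
    using assms by (simp add: fps_nth_mult_power_eq_0 less_le_trans)
qed


subsection \<open>q-Pochhammer symbols\<close>

lemma qpochhammer_0 [simp]: "qpochhammer a q 0 = 1"
  by (simp add: qpochhammer_def)

lemma qpochhammer_Suc: "qpochhammer a q (Suc n) = qpochhammer a q n * (1 - a * q ^ n)"
  by (simp add: qpochhammer_def)

lemma qpochhammer_mult_uminus:
  "qpochhammer a q n * qpochhammer (- a) q n = qpochhammer (a\<^sup>2) (q\<^sup>2) n"
  unfolding qpochhammer_def prod.distrib[symmetric]
  by (rule prod.cong) (simp_all add: algebra_simps power2_eq_square power_mult_distrib)

lemma qpochhammer_nth_0: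
  fixes a q :: "'a::comm_ring_1 fps"
  assumes "a $ 0 = 0"
  shows "qpochhammer a q n $ 0 = 1"
  using assms by (induction n) (simp_all add: qpochhammer_Suc)

lemma qpochhammer_LIMSEQ:
  fixes a q :: "'a::comm_ring_1 fps"
  assumes "q $ 0 = 0"
  shows "qpochhammer a q \<longlonglongrightarrow> qpochhammer_inf a q"
  using convergent_qpochhammer[OF assms] by (simp add: qpochhammer_inf_def convergent_LIMSEQ_iff)

lemma qpochhammer_inf_neq_0:
  fixes a q :: "'a::comm_ring_1 fps"
  assumes "a $ 0 = 0" "q $ 0 = 0"
  shows "qpochhammer_inf a q \<noteq> 0"
proof -
  have "\<forall>\<^sub>F n in sequentially. qpochhammer a q n $ 0 = qpochhammer_inf a q $ 0"
    using qpochhammer_LIMSEQ[OF assms(2)] by (simp add: tendsto_fps_iff)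
  then have "qpochhammer_inf a q $ 0 = 1"
    by (simp add: qpochhammer_nth_0[OF assms(1)] eventually_const_iff)
  then show ?thesis
    by auto
qed

lemma qpochhammer_inf_mult_uminus:
  fixes a q :: "'a::comm_ring_1 fps"
  assumes "q $ 0 = 0"
  shows "qpochhammer_inf a q * qpochhammer_inf (- a) q = qpochhammer_inf (a\<^sup>2) (q\<^sup>2)"
proof (rule LIMSEQ_unique)
  show "(\<lambda>n. qpochhammer a q n * qpochhammer (- a) q n)
      \<longlonglongrightarrow> qpochhammer_inf a q * qpochhammer_inf (- a) q"
    using assms by (intro tendsto_mult qpochhammer_LIMSEQ)
  show "(\<lambda>n. qpochhammer a q n * qpochhammer (- a) q n) \<longlonglongrightarrow> qpochhammer_inf (a\<^sup>2) (q\<^sup>2)"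
    unfolding qpochhammer_mult_uminus
    by (intro qpochhammer_LIMSEQ) (simp add: assms power2_eq_square)
qed

lemma prod_odd_eq_qpochhammer:
  fixes c q :: "'a::comm_ring_1"
  shows "(\<Prod>i | i \<in> {1..2 * n} \<and> odd i. 1 - c * q ^ i) = qpochhammer (c * q) (q\<^sup>2) n"
  unfolding prod.inter_filter[OF finite_atLeastAtMost]
  by (induction n) (simp_all add: qpochhammer_Suc mult.assoc flip: power_mult)

lemma prod_even_eq_qpochhammer:
  fixes c q :: "'a::comm_ring_1"
  shows "(\<Prod>i | i \<in> {1..2 * n} \<and> even i. 1 - c * q ^ i) = qpochhammer (c * q\<^sup>2) (q\<^sup>2) n"
  unfolding prod.inter_filter[OF finite_atLeastAtMost]
  by (induction n) (simp_all add: qpochhammer_Suc mult.assoc power_mult power2_eq_square)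


subsection \<open>Gauss's identity for triangular exponents\<close>

definition shanks_term :: "'a::comm_ring_1 \<Rightarrow> nat \<Rightarrow> nat \<Rightarrow> 'a" where
  "shanks_term q n s =
    q ^ (s * (2 * n + 1)) * qpochhammer q (q\<^sup>2) s * (\<Prod>k=Suc s..n. 1 - q ^ (2 * k))"

lemma sum_shanks_term_Suc:
  "(\<Sum>s\<le>n. shanks_term q (Suc n) s) - (1 - q ^ (2 * n + 1)) * (\<Sum>s\<le>n. shanks_term q n s) =
    qpochhammer q (q\<^sup>2) (Suc n) * q ^ (Suc n * (2 * n + 1))"
proof -
  let ?tail = "\<lambda>s. \<Prod>k=s..n. 1 - q ^ (2 * k)"
  let ?U = "\<lambda>s. q ^ (s * (2 * n + 1)) * qpochhammer q (q\<^sup>2) s * ?tail s"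
  have telescoping:
    "shanks_term q (Suc n) s - (1 - q ^ (2 * n + 1)) * shanks_term q n s = ?U (Suc s) - ?U s"
    if "s \<le> n" for s
  proof -
    have tails: "?tail s = (1 - q ^ (2 * s)) * ?tail (Suc s)"
        "(\<Prod>k=Suc s..Suc n. 1 - q ^ (2 * k)) = ?tail (Suc s) * (1 - q ^ (2 * n + 1) * q)"
      using that by (simp_all add: prod.atLeast_Suc_atMost mult_ac)
    have qpochhammer_step: "qpochhammer q (q\<^sup>2) (Suc s) = qpochhammer q (q\<^sup>2) s * (1 - q ^ (2 * s) * q)"
      by (simp add: qpochhammer_Suc mult.commute flip: power_mult)
    have powers: "q ^ (s * (2 * Suc n + 1)) = q ^ (s * (2 * n + 1)) * q ^ (2 * s)"
        "q ^ (Suc s * (2 * n + 1)) = q ^ (s * (2 * n + 1)) * q ^ (2 * n + 1)"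
      by (simp_all add: algebra_simps flip: power_add)
    show ?thesis
      unfolding shanks_term_def tails qpochhammer_step powers by (simp only: algebra_simps mult_1_left)
  qed
  have "(\<Sum>s\<le>n. shanks_term q (Suc n) s) - (1 - q ^ (2 * n + 1)) * (\<Sum>s\<le>n. shanks_term q n s) =
      (\<Sum>s<Suc n. ?U (Suc s) - ?U s)"
    unfolding sum_distrib_left sum_subtractf[symmetric] lessThan_Suc_atMost
    by (intro sum.cong refl telescoping) simp
  also have "\<dots> = ?U (Suc n) - ?U 0"
    by (rule sum_lessThan_telescope)
  also have "\<dots> = qpochhammer q (q\<^sup>2) (Suc n) * q ^ (Suc n * (2 * n + 1))"
    by (simp add: prod.atLeast_Suc_atMost)
  finally show ?thesis .
qed

lemma shanks_finite_gauss:
  "qpochhammer q (q\<^sup>2) n * (\<Sum>i\<le>2 * n. q ^ (Suc i choose 2)) = (\<Sum>s\<le>n. shanks_term q n s)"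
proof (induction n)
  case 0
  show ?case
    by (simp add: shanks_term_def numeral_2_eq_2)
next
  case (Suc n)
  let ?D = "qpochhammer q (q\<^sup>2)" and ?r = "1 - q ^ (2 * n + 1)"
  have "Suc (2 * n + 1) choose 2 = Suc n * (2 * n + 1)"
      "Suc (2 * n + 2) choose 2 = Suc n * (2 * Suc n + 1)"
    by (simp_all add: choose_two algebra_simps)
  then have "(\<Sum>i\<le>2 * Suc n. q ^ (Suc i choose 2)) =
      (\<Sum>i\<le>2 * n. q ^ (Suc i choose 2)) + q ^ (Suc n * (2 * n + 1)) + q ^ (Suc n * (2 * Suc n + 1))"
    by (simp del: binomial_Suc_Suc)
  moreover have "?D (Suc n) = ?r * ?D n"
    by (simp add: qpochhammer_Suc mult.commute flip: power_mult)
  ultimately have "?D (Suc n) * (\<Sum>i\<le>2 * Suc n. q ^ (Suc i choose 2)) =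
      ?r * (?D n * (\<Sum>i\<le>2 * n. q ^ (Suc i choose 2)))
        + ?D (Suc n) * q ^ (Suc n * (2 * n + 1)) + ?D (Suc n) * q ^ (Suc n * (2 * Suc n + 1))"
    by (simp only: distrib_left mult.assoc)
  also have "\<dots> = (\<Sum>s\<le>n. shanks_term q (Suc n) s) + ?D (Suc n) * q ^ (Suc n * (2 * Suc n + 1))"
    unfolding Suc.IH sum_shanks_term_Suc[symmetric] by simp
  also have "\<dots> = (\<Sum>s\<le>Suc n. shanks_term q (Suc n) s)"
    by (simp add: shanks_term_def mult.commute del: mult_Suc mult_Suc_right)
  finally show ?case .
qed

lemma sum_shanks_term_eq:
  "(\<Sum>s\<le>n. shanks_term q n s) = qpochhammer (q\<^sup>2) (q\<^sup>2) n +
    (\<Sum>s<n. q ^ (s * (2 * n + 1)) * qpochhammer q (q\<^sup>2) (Suc s) *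
      (\<Prod>k=Suc (Suc s)..n. 1 - q ^ (2 * k))) * q ^ (2 * n + 1)"
proof -
  have "shanks_term q n 0 = qpochhammer (q\<^sup>2) (q\<^sup>2) n"
    by (simp add: shanks_term_def qpochhammer_def prod.atLeast1_atMost_eq power_mult)
  moreover have "shanks_term q n (Suc s) = q ^ (s * (2 * n + 1)) * qpochhammer q (q\<^sup>2) (Suc s) *
      (\<Prod>k=Suc (Suc s)..n. 1 - q ^ (2 * k)) * q ^ (2 * n + 1)" for s
    unfolding shanks_term_def mult_Suc power_add by (simp only: mult_ac)
  ultimately show ?thesis
    by (simp only: sum.atMost_shift sum_distrib_right)
qed

lemma summable_triangular_powers:
  fixes q :: "'a::comm_ring_1 fps"
  assumes "q $ 0 = 0"
  shows "summable (\<lambda>i. q ^ (Suc i choose 2))"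
  using summable_fps_mult_power[OF assms, of "\<lambda>i. Suc i choose 2" "\<lambda>_. 1"]
  by (simp add: numeral_2_eq_2)

lemma gauss_triangular:
  fixes q :: "'a::comm_ring_1 fps"
  assumes "q $ 0 = 0"
  shows "qpochhammer_inf q (q\<^sup>2) * (\<Sum>i. q ^ (Suc i choose 2)) = qpochhammer_inf (q\<^sup>2) (q\<^sup>2)"
proof (rule LIMSEQ_unique)
  let ?S = "\<lambda>n. qpochhammer q (q\<^sup>2) n * (\<Sum>i<Suc (2 * n). q ^ (Suc i choose 2))"
  have q2: "q\<^sup>2 $ 0 = 0"
    using assms by (simp add: power2_eq_square)
  have "(\<lambda>n. \<Sum>i<n. q ^ (Suc i choose 2)) \<longlonglongrightarrow> (\<Sum>i. q ^ (Suc i choose 2))"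
    using assms by (intro summable_LIMSEQ summable_triangular_powers)
  then have "(\<lambda>n. \<Sum>i<Suc (2 * n). q ^ (Suc i choose 2)) \<longlonglongrightarrow> (\<Sum>i. q ^ (Suc i choose 2))"
    by (rule filterlim_compose[OF _ filterlim_subseq]) (simp add: strict_mono_def)
  then show "?S \<longlonglongrightarrow> qpochhammer_inf q (q\<^sup>2) * (\<Sum>i. q ^ (Suc i choose 2))"
    by (intro tendsto_mult qpochhammer_LIMSEQ q2)
  show "?S \<longlonglongrightarrow> qpochhammer_inf (q\<^sup>2) (q\<^sup>2)"
    unfolding lessThan_Suc_atMost shanks_finite_gauss sum_shanks_term_eq
    using tendsto_add[OF qpochhammer_LIMSEQ[OF q2]
        tendsto_fps_mult_power_0[OF assms, of "\<lambda>n. 2 * n + 1"]] by simp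
qed


subsection \<open>Partitions with prescribed multiplicities\<close>

definition restricted_partitions :: "(nat \<Rightarrow> nat set) \<Rightarrow> nat \<Rightarrow> nat multiset set" where
  "restricted_partitions C n = {\<mu> \<in> partitions_of n. \<forall>i. count \<mu> i \<in> C i}"

definition partition_gf :: "(nat \<Rightarrow> nat set) \<Rightarrow> 'a::comm_ring_1 fps" where
  "partition_gf C = Abs_fps (\<lambda>n. of_nat (card (restricted_partitions C n)))"

definition statistic_gf :: "(nat \<Rightarrow> nat set) \<Rightarrow> (nat multiset \<Rightarrow> nat) \<Rightarrow> 'a::comm_ring_1 fps" where
  "statistic_gf C f = Abs_fps (\<lambda>n. of_nat (\<Sum>\<mu>\<in>restricted_partitions C n. f \<mu>))"

text \<open>For \<open>i > 0\<close> this is the sum of \<open>q\<^bsup>ic\<^esup>\<close> over \<open>c \<in> A\<close>: the part \<open>i\<close> occurs \<open>c\<close> times.\<close>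

definition part_series :: "nat set \<Rightarrow> nat \<Rightarrow> 'a::comm_ring_1 fps" where
  "part_series A i = Abs_fps (\<lambda>n. of_bool (i dvd n \<and> n div i \<in> A))"

lemma finite_restricted_partitions [simp]: "finite (restricted_partitions C n)"
  by (simp add: restricted_partitions_def finite_partitions_of)

lemma statistic_gf_affine:
  "statistic_gf C (\<lambda>\<mu>. c + d * f \<mu>) =
    (of_nat c * partition_gf C + of_nat d * statistic_gf C f :: 'a::comm_ring_1 fps)"
  by (simp add: fps_eq_iff statistic_gf_def partition_gf_def sum.distrib
      mult.commute flip: sum_distrib_left fps_of_nat)

lemma member_le_sum_mset: "i \<in># \<mu> \<Longrightarrow> i \<le> sum_mset \<mu>" for i :: nat
  by (auto dest: multi_member_split)

lemma count_mult_le_sum_mset: "i * count \<mu> i \<le> sum_mset \<mu>" for i :: nat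
  by (induction \<mu>) auto

lemma restricted_partitions_count_eq:
  assumes "c \<in> C i" "i > 0" "i * c \<le> n"
  shows "{\<mu> \<in> restricted_partitions C n. count \<mu> i = c} =
    (\<lambda>\<nu>. \<nu> + replicate_mset c i) ` restricted_partitions (C(i := {0})) (n - i * c)"
proof -
  have without_i: "\<nu> \<in> restricted_partitions (C(i := {0})) m \<longleftrightarrow>
      \<nu> \<in> partitions_of m \<and> count \<nu> i = 0 \<and> (\<forall>j. j \<noteq> i \<longrightarrow> count \<nu> j \<in> C j)" for \<nu> m
    by (auto simp: restricted_partitions_def split: if_splits)
  show ?thesis
  proof (intro equalityI subsetI)
    fix \<mu>
    assume \<mu>: "\<mu> \<in> {\<mu> \<in> restricted_partitions C n. count \<mu> i = c}"
    define \<nu> where "\<nu> = \<mu> - replicate_mset c i"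
    have \<mu>_split: "\<mu> = \<nu> + replicate_mset c i"
      using \<mu> by (simp add: \<nu>_def count_le_replicate_mset_subset_eq[symmetric])
    have "\<nu> \<in> restricted_partitions (C(i := {0})) (n - i * c)"
      unfolding without_i using \<mu> unfolding \<mu>_split
      by (auto simp: restricted_partitions_def partitions_of_def mult.commute split: if_splits)
    then show "\<mu> \<in> (\<lambda>\<nu>. \<nu> + replicate_mset c i) ` restricted_partitions (C(i := {0})) (n - i * c)"
      using \<mu>_split by blast
  next
    fix \<mu>
    assume "\<mu> \<in> (\<lambda>\<nu>. \<nu> + replicate_mset c i) ` restricted_partitions (C(i := {0})) (n - i * c)"
    then obtain \<nu> where "\<mu> = \<nu> + replicate_mset c i" "\<nu> \<in> partitions_of (n - i * c)"
        "count \<nu> i = 0" "\<forall>j. j \<noteq> i \<longrightarrow> count \<nu> j \<in> C j"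
      by (auto simp: without_i)
    then show "\<mu> \<in> {\<mu> \<in> restricted_partitions C n. count \<mu> i = c}"
      using assms by (auto simp: restricted_partitions_def partitions_of_def mult.commute)
  qed
qed

lemma card_restricted_partitions_weight_eq:
  assumes "i > 0" "k \<le> n"
  shows "card {\<mu> \<in> restricted_partitions C n. i * count \<mu> i = k} =
    of_bool (i dvd k \<and> k div i \<in> C i) * card (restricted_partitions (C(i := {0})) (n - k))"
proof (cases "i dvd k \<and> k div i \<in> C i")
  case True
  then obtain c where k_eq: "k = i * c" and "c \<in> C i"
    using assms(1) by auto
  have "{\<mu> \<in> restricted_partitions C n. i * count \<mu> i = k} =
      (\<lambda>\<mu>. \<mu> + replicate_mset c i) ` restricted_partitions (C(i := {0})) (n - k)"
    using restricted_partitions_count_eq[of c C i n] assms \<open>c \<in> C i\<close> k_eq by auto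
  moreover have "inj (\<lambda>\<mu>. \<mu> + replicate_mset c i)"
    by (simp add: inj_def)
  ultimately show ?thesis
    using True by (simp add: card_image inj_on_subset)
next
  case False
  then have "{\<mu> \<in> restricted_partitions C n. i * count \<mu> i = k} = {}"
    using assms(1) by (auto simp: restricted_partitions_def)
  then show ?thesis
    by (simp only: False card.empty) simp
qed

lemma partition_gf_split_part:
  assumes "i > 0"
  shows "partition_gf C = part_series (C i) i * partition_gf (C(i := {0}))"
proof (rule fps_ext)
  fix n
  have weight_le: "i * count \<mu> i \<le> n" if "\<mu> \<in> restricted_partitions C n" for \<mu>
    using that count_mult_le_sum_mset[of i \<mu>]
    by (simp add: restricted_partitions_def partitions_of_def)
  have "card (restricted_partitions C n) =
      (\<Sum>k=0..n. card {\<mu> \<in> restricted_partitions C n. i * count \<mu> i = k})"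
    unfolding card_eq_sum using weight_le by (intro sum.group[symmetric]) auto
  also have "\<dots> = (\<Sum>k=0..n. of_bool (i dvd k \<and> k div i \<in> C i) *
      card (restricted_partitions (C(i := {0})) (n - k)))"
    by (intro sum.cong refl card_restricted_partitions_weight_eq assms) simp
  finally show "partition_gf C $ n = (part_series (C i) i * partition_gf (C(i := {0}))) $ n"
    by (simp add: partition_gf_def part_series_def fps_mult_nth)
qed

lemma partition_gf_split:
  assumes "finite I" "0 \<notin> I"
  shows "partition_gf C = (\<Prod>i\<in>I. part_series (C i) i) *
    (partition_gf (\<lambda>i. if i \<in> I then {0} else C i) :: 'a::comm_ring_1 fps)"
  using assms
proof (induction I rule: finite_induct)
  case (insert j I)
  let ?C = "\<lambda>i. if i \<in> I then {0} else C i"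
  have "partition_gf C = (\<Prod>i\<in>I. part_series (C i) i) * (partition_gf ?C :: 'a fps)"
    using insert by simp
  also have "partition_gf ?C = part_series (C j) j * partition_gf (?C(j := {0}))"
    using insert.hyps insert.prems partition_gf_split_part[of j ?C] by simp
  also have "?C(j := {0}) = (\<lambda>i. if i \<in> insert j I then {0} else C i)"
    by (auto simp: fun_eq_iff)
  finally show ?case
    using insert.hyps by (simp add: mult_ac)
qed simp

lemma restricted_partitions_no_small_parts:
  assumes "\<And>i. 0 < i \<Longrightarrow> i \<le> n \<Longrightarrow> C i = {0}" "\<And>i. 0 \<in> C i"
  shows "restricted_partitions C n = (if n = 0 then {{#}} else {})"
proof -
  have "\<mu> = {#}" if "\<mu> \<in> restricted_partitions C n" for \<mu>
  proof (rule ccontr)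
    assume "\<mu> \<noteq> {#}"
    then obtain i where i: "i \<in># \<mu>"
      by blast
    have "0 < i" "i \<le> n" "count \<mu> i \<in> C i"
      using that i member_le_sum_mset[OF i]
      by (auto simp: restricted_partitions_def partitions_of_def intro!: gr0I)
    then show False
      using assms(1)[of i] i by (simp flip: count_greater_zero_iff)
  qed
  moreover have "{#} \<in> restricted_partitions C n \<longleftrightarrow> n = 0"
    using assms(2) by (simp add: restricted_partitions_def partitions_of_def)
  ultimately show ?thesis
    by auto
qed

lemma partition_gf_LIMSEQ:
  assumes "\<And>i. 0 \<in> C i"
  shows "(\<lambda>N. \<Prod>i=1..N. part_series (C i) i) \<longlonglongrightarrow> (partition_gf C :: 'a::comm_ring_1 fps)"
proof (rule tendsto_fpsI)
  fix n
  have "(\<Prod>i=1..N. part_series (C i) i) $ n = (partition_gf C :: 'a fps) $ n" if "n \<le> N" for N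
  proof -
    let ?P = "\<Prod>i=1..N. part_series (C i) i :: 'a fps"
    define C' where "C' i = (if i \<in> {1..N} then {0} else C i)" for i
    have rest: "partition_gf C' $ k = (of_bool (k = 0) :: 'a)" if "k \<le> n" for k
    proof -
      have "restricted_partitions C' k = (if k = 0 then {{#}} else {})"
        using that \<open>n \<le> N\<close> assms by (intro restricted_partitions_no_small_parts) (auto simp: C'_def)
      then show ?thesis
        by (simp add: partition_gf_def)
    qed
    have "partition_gf C = ?P * partition_gf C'"
      unfolding C'_def by (rule partition_gf_split) auto
    then have "partition_gf C $ n = (\<Sum>k=0..n. ?P $ k * of_bool (n - k = 0))"
      by (simp add: fps_mult_nth rest)
    also have "\<dots> = (\<Sum>k\<in>{n}. ?P $ k * of_bool (n - k = 0))"
      by (rule sum.mono_neutral_right) auto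
    finally show ?thesis
      by simp
  qed
  then show "\<forall>\<^sub>F N in sequentially.
      (\<Prod>i=1..N. part_series (C i) i) $ n = (partition_gf C :: 'a fps) $ n"
    by (rule eventually_sequentiallyI)
qed

lemma part_series_0_1: "i > 0 \<Longrightarrow> part_series {0, 1} i = 1 + fps_X ^ i"
  by (auto simp: part_series_def fps_eq_iff elim!: dvdE)

lemma part_series_1: "i > 0 \<Longrightarrow> part_series {1} i = fps_X ^ i"
  by (auto simp: part_series_def fps_eq_iff elim!: dvdE)

lemma part_series_pos: "i > 0 \<Longrightarrow> part_series (UNIV - {0}) i = fps_X ^ i * part_series UNIV i"
  by (auto simp: part_series_def fps_eq_iff fps_X_power_mult_nth div_eq_0_iff
      dvd_diff_nat dest: dvd_imp_le dvd_diffD)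

lemma part_series_UNIV:
  assumes "i > 0"
  shows "part_series UNIV i * (1 - fps_X ^ i) = (1 :: 'a::comm_ring_1 fps)"
proof -
  have "part_series UNIV i = (1 + part_series (UNIV - {0}) i :: 'a fps)"
    using assms by (auto simp: part_series_def fps_eq_iff elim!: dvdE)
  then show ?thesis
    unfolding part_series_pos[OF assms] by (simp add: algebra_simps)
qed


subsection \<open>Partitions without repeated parts of a given kind\<close>

definition no_repeat :: "(nat \<Rightarrow> bool) \<Rightarrow> nat \<Rightarrow> nat set" where
  "no_repeat Q i = (if Q i then {0, 1} else UNIV)"

lemma mem_no_repeat: "c \<in> no_repeat Q i \<longleftrightarrow> (Q i \<longrightarrow> c \<le> 1)"
  by (auto simp: no_repeat_def)

lemma P_od_eq: "P_od n = restricted_partitions (no_repeat odd) n"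
  by (simp add: P_od_def restricted_partitions_def mem_no_repeat)

lemma Abs_fps_sigma_od:
  "Abs_fps (\<lambda>n. of_nat (sigma_od_moex n)) = statistic_gf (no_repeat odd) moex"
  "Abs_fps (\<lambda>n. of_nat (sigma_od_meex n)) = statistic_gf (no_repeat odd) meex"
  by (simp_all add: sigma_od_moex_def sigma_od_meex_def statistic_gf_def P_od_eq)

lemma p_ed_eq: "p_ed n = card (restricted_partitions (no_repeat even) n)"
  by (simp add: p_ed_def restricted_partitions_def mem_no_repeat)

lemma prod_part_series_no_repeat:
  "(\<Prod>i=1..N. part_series (no_repeat Q i) i) *
      (\<Prod>i | i \<in> {1..N} \<and> \<not> Q i. 1 - fps_X ^ i) =
    (\<Prod>i | i \<in> {1..N} \<and> Q i. 1 + fps_X ^ i :: 'a::comm_ring_1 fps)"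
  unfolding prod.inter_filter[OF finite_atLeastAtMost] prod.distrib[symmetric]
  by (intro prod.cong)
     (simp_all add: no_repeat_def part_series_0_1 part_series_UNIV del: One_nat_def)

lemma partition_gf_no_repeat:
  fixes A B :: "'a::comm_ring_1 fps"
  assumes "(\<lambda>n. \<Prod>i | i \<in> {1..2 * n} \<and> \<not> Q i. 1 - fps_X ^ i) \<longlonglongrightarrow> A"
    and "(\<lambda>n. \<Prod>i | i \<in> {1..2 * n} \<and> Q i. 1 + fps_X ^ i) \<longlonglongrightarrow> B"
  shows "partition_gf (no_repeat Q) * A = B"
proof (rule LIMSEQ_unique[OF _ assms(2)])
  have "(\<lambda>n. \<Prod>i=1..2 * n. part_series (no_repeat Q i) i) \<longlonglongrightarrow> partition_gf (no_repeat Q)"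
    by (rule filterlim_compose[OF partition_gf_LIMSEQ filterlim_subseq])
       (simp_all add: mem_no_repeat strict_mono_def)
  from tendsto_mult[OF this assms(1)]
  show "(\<lambda>n. \<Prod>i | i \<in> {1..2 * n} \<and> Q i. 1 + fps_X ^ i) \<longlonglongrightarrow> partition_gf (no_repeat Q) * A"
    unfolding prod_part_series_no_repeat .
qed

lemma partition_gf_no_repeat_odd:
  "partition_gf (no_repeat odd) * qpochhammer_inf (fps_X\<^sup>2) (fps_X\<^sup>2) =
    qpochhammer_inf (- fps_X :: 'a::comm_ring_1 fps) (fps_X\<^sup>2)"
proof (rule partition_gf_no_repeat)
  show "(\<lambda>n. \<Prod>i | i \<in> {1..2 * n} \<and> \<not> odd i. 1 - fps_X ^ i :: 'a fps)
      \<longlonglongrightarrow> qpochhammer_inf (fps_X\<^sup>2) (fps_X\<^sup>2)"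
    using prod_even_eq_qpochhammer[where c = 1 and q = "fps_X :: 'a fps"]
    by (simp add: qpochhammer_LIMSEQ)
  show "(\<lambda>n. \<Prod>i | i \<in> {1..2 * n} \<and> odd i. 1 + fps_X ^ i :: 'a fps)
      \<longlonglongrightarrow> qpochhammer_inf (- fps_X) (fps_X\<^sup>2)"
    using prod_odd_eq_qpochhammer[where c = "- 1" and q = "fps_X :: 'a fps"]
    by (simp add: qpochhammer_LIMSEQ)
qed

lemma partition_gf_no_repeat_even:
  "partition_gf (no_repeat even) * qpochhammer_inf fps_X (fps_X\<^sup>2) =
    qpochhammer_inf (- (fps_X\<^sup>2) :: 'a::comm_ring_1 fps) (fps_X\<^sup>2)"
proof (rule partition_gf_no_repeat)
  show "(\<lambda>n. \<Prod>i | i \<in> {1..2 * n} \<and> odd i. 1 - fps_X ^ i :: 'a fps)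
      \<longlonglongrightarrow> qpochhammer_inf fps_X (fps_X\<^sup>2)"
    using prod_odd_eq_qpochhammer[where c = 1 and q = "fps_X :: 'a fps"]
    by (simp add: qpochhammer_LIMSEQ)
  show "(\<lambda>n. \<Prod>i | i \<in> {1..2 * n} \<and> even i. 1 + fps_X ^ i :: 'a fps)
      \<longlonglongrightarrow> qpochhammer_inf (- (fps_X\<^sup>2)) (fps_X\<^sup>2)"
    using prod_even_eq_qpochhammer[where c = "- 1" and q = "fps_X :: 'a fps"]
    by (simp add: qpochhammer_LIMSEQ)
qed


subsection \<open>Partitions containing given parts\<close>

definition containing :: "nat set \<Rightarrow> (nat \<Rightarrow> nat set) \<Rightarrow> nat \<Rightarrow> nat set" where
  "containing S C i = (if i \<in> S then C i - {0} else C i)"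

lemma restricted_partitions_containing:
  "restricted_partitions (containing S C) n = {\<mu> \<in> restricted_partitions C n. S \<subseteq> set_mset \<mu>}"
proof -
  have "(\<forall>i. count \<mu> i \<in> containing S C i) \<longleftrightarrow> (\<forall>i. count \<mu> i \<in> C i) \<and> S \<subseteq> set_mset \<mu>" for \<mu>
    by (auto simp: containing_def not_in_iff split: if_splits)
  then show ?thesis
    by (auto simp: restricted_partitions_def)
qed

lemma partition_gf_containing:
  assumes "finite S" "0 \<notin> S"
  shows "partition_gf (containing S C) =
    (\<Prod>i\<in>S. part_series (C i - {0}) i) * partition_gf (\<lambda>i. if i \<in> S then {0} else C i)"
proof -
  have "(\<lambda>i. if i \<in> S then {0} else containing S C i) = (\<lambda>i. if i \<in> S then {0} else C i)"
    by (auto simp: containing_def fun_eq_iff)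
  then show ?thesis
    using partition_gf_split[OF assms, of "containing S C"]
    by (simp add: containing_def cong: prod.cong)
qed

lemma partition_gf_containing_unrestricted:
  assumes "finite S" "0 \<notin> S" "\<And>i. i \<in> S \<Longrightarrow> C i = UNIV"
  shows "partition_gf (containing S C) = (partition_gf C * fps_X ^ \<Sum>S :: 'a::comm_ring_1 fps)"
proof -
  have "i > 0" if "i \<in> S" for i
    using assms(2) that by (metis gr0I)
  then have "(\<Prod>i\<in>S. part_series (C i - {0}) i) =
      fps_X ^ \<Sum>S * (\<Prod>i\<in>S. part_series (C i) i :: 'a fps)"
    unfolding power_sum prod.distrib[symmetric]
    by (intro prod.cong) (simp_all add: assms(3) part_series_pos)
  then show ?thesis
    unfolding partition_gf_containing[OF assms(1,2)] partition_gf_split[OF assms(1,2), of C]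
    by (simp only: mult_ac)
qed

lemma partition_gf_containing_distinct:
  assumes "finite S" "0 \<notin> S" "\<And>i. i \<in> S \<Longrightarrow> C i = {0, 1}"
  shows "partition_gf (containing S C) * (\<Prod>i\<in>S. 1 + fps_X ^ i) =
    (partition_gf C * fps_X ^ \<Sum>S :: 'a::comm_ring_1 fps)"
proof -
  have pos: "i > 0" if "i \<in> S" for i
    using assms(2) that by (metis gr0I)
  then have "(\<Prod>i\<in>S. part_series (C i - {0}) i) = (fps_X ^ \<Sum>S :: 'a fps)"
    unfolding power_sum by (intro prod.cong) (simp_all add: assms(3) part_series_1 del: One_nat_def)
  moreover have "(\<Prod>i\<in>S. part_series (C i) i) = (\<Prod>i\<in>S. 1 + fps_X ^ i :: 'a fps)"
    using pos by (intro prod.cong) (simp_all add: assms(3) part_series_0_1 del: One_nat_def)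
  ultimately show ?thesis
    unfolding partition_gf_containing[OF assms(1,2)] partition_gf_split[OF assms(1,2), of C]
    by (simp only: mult_ac)
qed

lemma sum_odd_numbers: "(\<Sum>k<m. 2 * k + 1) = m\<^sup>2" for m :: nat
  by (induction m) (simp_all add: power2_eq_square)

lemma sum_even_numbers: "(\<Sum>k<m. 2 * k + 2) = 2 * (Suc m choose 2)" for m :: nat
  by (induction m) (simp_all add: numeral_2_eq_2)

lemma partition_gf_containing_odd:
  "partition_gf (containing ((\<lambda>k. 2 * k + 1) ` {..<m}) (no_repeat odd)) =
    (partition_gf (no_repeat odd) *
      (fps_X ^ m\<^sup>2 * inverse (qpochhammer (- fps_X) (fps_X\<^sup>2) m)) :: 'a::field fps)"
proof -
  let ?S = "(\<lambda>k. 2 * k + 1) ` {..<m}" and ?D = "qpochhammer (- fps_X) (fps_X\<^sup>2) m :: 'a fps"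
  have inj: "inj_on (\<lambda>k. 2 * k + 1 :: nat) A" for A
    by (simp add: inj_on_def)
  have "(\<Prod>i\<in>?S. 1 + fps_X ^ i) = ?D"
    unfolding prod.reindex[OF inj] by (simp add: qpochhammer_def flip: power_mult)
  moreover have "\<Sum>?S = m\<^sup>2"
    unfolding sum.reindex[OF inj] sum_odd_numbers[symmetric] by simp
  moreover have "partition_gf (containing ?S (no_repeat odd)) * (\<Prod>i\<in>?S. 1 + fps_X ^ i) =
      (partition_gf (no_repeat odd) * fps_X ^ \<Sum>?S :: 'a fps)"
    by (rule partition_gf_containing_distinct) (auto simp: no_repeat_def)
  ultimately have "partition_gf (containing ?S (no_repeat odd)) * (?D * inverse ?D) =
      partition_gf (no_repeat odd) * (fps_X ^ m\<^sup>2 * inverse ?D)"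
    by (simp only: mult.assoc[symmetric])
  moreover have "?D * inverse ?D = 1"
    by (rule inverse_mult_eq_1') (simp add: qpochhammer_nth_0)
  ultimately show ?thesis
    by (simp only: mult_1_right)
qed

lemma partition_gf_containing_even:
  "partition_gf (containing ((\<lambda>k. 2 * k + 2) ` {..<m}) (no_repeat odd)) =
    (partition_gf (no_repeat odd) * (fps_X\<^sup>2) ^ (Suc m choose 2) :: 'a::comm_ring_1 fps)"
proof -
  let ?S = "(\<lambda>k. 2 * k + 2) ` {..<m}"
  have "\<Sum>?S = 2 * (Suc m choose 2)"
    unfolding sum_even_numbers[symmetric] by (simp add: sum.reindex inj_on_def)
  moreover have "partition_gf (containing ?S (no_repeat odd)) =
      (partition_gf (no_repeat odd) * fps_X ^ \<Sum>?S :: 'a fps)"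
    by (rule partition_gf_containing_unrestricted) (auto simp: no_repeat_def)
  ultimately show ?thesis
    by (simp only: power_mult)
qed


subsection \<open>Minimal excludants\<close>

lemma Least_range:
  fixes g :: "nat \<Rightarrow> nat"
  assumes "mono g" "P (g t)"
  shows "(LEAST k. k \<in> range g \<and> P k) = g (LEAST t. P (g t))"
proof -
  have "\<exists>t\<in>{t. P (g t)}. \<forall>u\<in>{t. P (g t)}. t \<le> u"
    using LeastI[of "\<lambda>t. P (g t)", OF assms(2)] Least_le[of "\<lambda>t. P (g t)"] by blast
  then have "(LEAST k. k \<in> g ` {t. P (g t)}) = g (LEAST t. t \<in> {t. P (g t)})"
    by (rule Least_mono[OF assms(1)])
  moreover have "k \<in> g ` {t. P (g t)} \<longleftrightarrow> k \<in> range g \<and> P k" for k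
    by auto
  ultimately show ?thesis
    by simp
qed

lemma moex_eq: "moex \<mu> = 1 + 2 * (LEAST t. 2 * t + 1 \<notin># \<mu>)"
proof -
  have "odd k \<longleftrightarrow> k \<in> range (\<lambda>t. 2 * t + 1)" for k :: nat
    by (auto elim: oddE)
  moreover have "2 * sum_mset \<mu> + 1 \<notin># \<mu>"
    using member_le_sum_mset[of "2 * sum_mset \<mu> + 1" \<mu>] by auto
  ultimately show ?thesis
    unfolding moex_def
    using Least_range[where g = "\<lambda>t. 2 * t + 1" and P = "\<lambda>k. k \<notin># \<mu>"] by (simp add: mono_def)
qed

lemma meex_eq: "meex \<mu> = 2 + 2 * (LEAST t. 2 * t + 2 \<notin># \<mu>)"
proof -
  have "0 < k \<and> even k \<longleftrightarrow> k \<in> range (\<lambda>t. 2 * t + 2)" for k :: nat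
    by (simp add: image_iff) presburger
  moreover have "2 * sum_mset \<mu> + 2 \<notin># \<mu>"
    using member_le_sum_mset[of "2 * sum_mset \<mu> + 2" \<mu>] by auto
  ultimately show ?thesis
    unfolding meex_def conj_assoc[symmetric]
    using Least_range[where g = "\<lambda>t. 2 * t + 2" and P = "\<lambda>k. k \<notin># \<mu>"] by (simp add: mono_def)
qed

lemma card_lessThan_all_not_eq_Least:
  fixes P :: "nat \<Rightarrow> bool"
  assumes "P n" "n \<le> N"
  shows "card {m \<in> {..<N}. \<forall>k\<le>m. \<not> P k} = (LEAST t. P t)"
proof -
  have "(\<forall>k\<le>m. \<not> P k) \<longleftrightarrow> m < (LEAST t. P t)" for m
    using LeastI[of P, OF assms(1)] not_less_Least[of _ P] le_less_trans leI by blast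
  moreover have "(LEAST t. P t) \<le> N"
    using Least_le[of P, OF assms(1)] assms(2) by simp
  ultimately have "{m \<in> {..<N}. \<forall>k\<le>m. \<not> P k} = {..<LEAST t. P t}"
    by auto
  then show ?thesis
    by simp
qed

lemma sums_Least_not_part:
  assumes "\<And>k. k < g k"
  shows "(\<lambda>m. partition_gf (containing (g ` {..<Suc m}) C)) sums
    (statistic_gf C (\<lambda>\<mu>. LEAST t. g t \<notin># \<mu>) :: 'a::comm_ring_1 fps)"
  unfolding sums_def
proof (rule tendsto_fpsI)
  fix n
  have "(\<Sum>m<N. card (restricted_partitions (containing (g ` {..<Suc m}) C) n)) =
      (\<Sum>\<mu>\<in>restricted_partitions C n. LEAST t. g t \<notin># \<mu>)" if "n \<le> N" for N
  proof -
    have "card {m \<in> {..<N}. \<forall>k\<le>m. g k \<in># \<mu>} = (LEAST t. g t \<notin># \<mu>)"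
      if "\<mu> \<in> restricted_partitions C n" for \<mu>
    proof -
      have "g n \<notin># \<mu>"
        using that assms[of n] member_le_sum_mset[of "g n" \<mu>]
        by (auto simp: restricted_partitions_def partitions_of_def)
      from card_lessThan_all_not_eq_Least[of "\<lambda>t. g t \<notin># \<mu>", OF this \<open>n \<le> N\<close>] show ?thesis
        by simp
    qed
    moreover have "restricted_partitions (containing (g ` {..<Suc m}) C) n =
        {\<mu> \<in> restricted_partitions C n. \<forall>k\<le>m. g k \<in># \<mu>}" for m
      unfolding restricted_partitions_containing lessThan_Suc_atMost by blast
    ultimately show ?thesis
      using sum_multicount_gen[of "{..<N}" "restricted_partitions C n" "\<lambda>m \<mu>. \<forall>k\<le>m. g k \<in># \<mu>"]
      by simp
  qed
  then have "(\<Sum>m<N. partition_gf (containing (g ` {..<Suc m}) C)) $ n =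
      (statistic_gf C (\<lambda>\<mu>. LEAST t. g t \<notin># \<mu>) :: 'a fps) $ n" if "n \<le> N" for N
    using that by (simp add: partition_gf_def statistic_gf_def fps_sum_nth flip: of_nat_sum)
  then show "\<forall>\<^sub>F N in sequentially. (\<Sum>m<N. partition_gf (containing (g ` {..<Suc m}) C)) $ n =
      (statistic_gf C (\<lambda>\<mu>. LEAST t. g t \<notin># \<mu>) :: 'a fps) $ n"
    by (rule eventually_sequentiallyI)
qed

lemma sums_sigma_star:
  "(\<lambda>m. 2 * (fps_X ^ (Suc m)\<^sup>2 * inverse (qpochhammer (- fps_X) (fps_X\<^sup>2) (Suc m)))) sums
    sigma_star (- fps_X :: 'a::field fps)"
proof -
  let ?f = "\<lambda>q m. (- 1) ^ Suc m * q ^ ((Suc m)\<^sup>2) / qpochhammer q (q\<^sup>2) (Suc m) :: 'a fps"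
  have "?f (- fps_X) m = fps_X ^ (Suc m)\<^sup>2 * inverse (qpochhammer (- fps_X) (fps_X\<^sup>2) (Suc m))"
    for m
  proof -
    have "(- 1) ^ Suc m * (- fps_X) ^ ((Suc m)\<^sup>2) = (fps_X ^ (Suc m)\<^sup>2 :: 'a fps)"
      by (cases "even m") (simp_all add: uminus_power_if del: power_Suc)
    then show ?thesis
      by (simp add: fps_divide_unit qpochhammer_nth_0 del: power_Suc)
  qed
  moreover have "?f (- fps_X) sums suminf (?f (- fps_X))"
    by (intro summable_sums summable_sigma_star) simp
  ultimately show ?thesis
    unfolding sigma_star_def by (intro sums_cmult_left) simp
qed

lemma statistic_gf_moex:
  "statistic_gf (no_repeat odd) moex =
    (partition_gf (no_repeat odd) * (1 + sigma_star (- fps_X)) :: 'a::field fps)"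
proof -
  let ?G = "partition_gf (no_repeat odd) :: 'a fps"
  let ?f = "\<lambda>m. fps_X ^ m\<^sup>2 * inverse (qpochhammer (- fps_X) (fps_X\<^sup>2) m) :: 'a fps"
  let ?L = "statistic_gf (no_repeat odd) (\<lambda>\<mu>. LEAST t. 2 * t + 1 \<notin># \<mu>) :: 'a fps"
  have "(\<lambda>m. ?G * ?f (Suc m)) sums ?L"
    unfolding partition_gf_containing_odd[symmetric] by (rule sums_Least_not_part) simp
  then have "(\<lambda>m. ?G * (2 * ?f (Suc m))) sums (2 * ?L)"
    unfolding mult.left_commute[of ?G] by (rule sums_cmult_left)
  then have "2 * ?L = ?G * sigma_star (- fps_X)"
    using sums_cmult_left[OF sums_sigma_star] by (rule sums_unique2)
  then show ?thesis
    unfolding moex_eq[abs_def] statistic_gf_affine by (simp add: distrib_left)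
qed

lemma statistic_gf_meex:
  "statistic_gf (no_repeat odd) meex =
    (2 * (partition_gf (no_repeat odd) * (\<Sum>m. (fps_X\<^sup>2) ^ (Suc m choose 2)))
      :: 'a::comm_ring_1 fps)"
proof -
  let ?G = "partition_gf (no_repeat odd) :: 'a fps"
  let ?f = "\<lambda>m. (fps_X\<^sup>2) ^ (Suc m choose 2) :: 'a fps"
  let ?L = "statistic_gf (no_repeat odd) (\<lambda>\<mu>. LEAST t. 2 * t + 2 \<notin># \<mu>) :: 'a fps"
  have "(\<lambda>m. ?G * ?f (Suc m)) sums ?L"
    unfolding partition_gf_containing_even[symmetric] by (rule sums_Least_not_part) simp
  then have "(\<lambda>m. ?G * ?f m) sums (?L + ?G * ?f 0)"
    by (rule sums_Suc)
  moreover have "(\<lambda>m. ?G * ?f m) sums (?G * suminf ?f)"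
    by (intro sums_cmult_left summable_sums summable_triangular_powers) simp
  ultimately have "?L + ?G * ?f 0 = ?G * suminf ?f"
    by (rule sums_unique2)
  then have "2 * ?G + 2 * ?L = 2 * (?G * suminf ?f)"
    by (simp add: binomial_eq_0 algebra_simps flip: distrib_left)
  then show ?thesis
    unfolding meex_eq[abs_def] statistic_gf_affine by simp
qed

lemma partition_gf_no_repeat_odd_mult_triangular:
  "partition_gf (no_repeat odd) * (\<Sum>m. (fps_X\<^sup>2) ^ (Suc m choose 2)) =
    (partition_gf (no_repeat even) :: 'a::field fps)"
proof -
  let ?y = "fps_X\<^sup>2 :: 'a fps"
  let ?T = "\<Sum>m. ?y ^ (Suc m choose 2)" and ?G = "partition_gf (no_repeat odd) :: 'a fps"
  let ?A = "qpochhammer_inf fps_X ?y" and ?B = "qpochhammer_inf (- fps_X) ?y"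
    and ?N = "qpochhammer_inf ?y ?y"
  have y: "?y $ 0 = 0"
    by simp
  have "?A * ?B * ?T = ?N * qpochhammer_inf (- ?y) ?y"
    unfolding qpochhammer_inf_mult_uminus[OF y] by (rule gauss_triangular[OF y])
  also have "\<dots> = ?N * (partition_gf (no_repeat even) * ?A)"
    by (simp only: partition_gf_no_repeat_even)
  finally have "?A * ?N * (?G * ?T) = ?A * ?N * partition_gf (no_repeat even)"
    unfolding partition_gf_no_repeat_odd[symmetric] by (simp only: mult_ac)
  then show ?thesis
    by (simp add: qpochhammer_inf_neq_0)
qed

theorem theorem1p4:
  shows "(Abs_fps (\<lambda>n. of_nat (sigma_od_moex n)) :: 'a::field_char_0 fps) =
           qpochhammer_inf (- fps_X) (fps_X\<^sup>2) / qpochhammer_inf (fps_X\<^sup>2) (fps_X\<^sup>2)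
             * (1 + sigma_star (- fps_X))
       \<and> (Abs_fps (\<lambda>n. of_nat (sigma_od_meex n)) :: 'a fps) =
           2 * Abs_fps (\<lambda>n. of_nat (p_ed n))"
proof
  let ?y = "fps_X\<^sup>2 :: 'a fps"
  have "qpochhammer_inf ?y ?y \<noteq> 0"
    by (simp add: qpochhammer_inf_neq_0)
  then have "qpochhammer_inf (- fps_X) ?y / qpochhammer_inf ?y ?y = partition_gf (no_repeat odd)"
    unfolding partition_gf_no_repeat_odd[symmetric] by (rule nonzero_mult_div_cancel_right)
  then show "(Abs_fps (\<lambda>n. of_nat (sigma_od_moex n)) :: 'a fps) =
      qpochhammer_inf (- fps_X) ?y / qpochhammer_inf ?y ?y * (1 + sigma_star (- fps_X))"
    by (simp only: Abs_fps_sigma_od statistic_gf_moex)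
  show "(Abs_fps (\<lambda>n. of_nat (sigma_od_meex n)) :: 'a fps) = 2 * Abs_fps (\<lambda>n. of_nat (p_ed n))"
    unfolding Abs_fps_sigma_od statistic_gf_meex partition_gf_no_repeat_odd_mult_triangular
    by (simp only: partition_gf_def p_ed_eq)
qed

end
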